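(* Let $F\subseteq\mathbb{R}$ contain arbitrarily large numbers (i.e. for each $M\in\mathbb{R}$ there is $x\in F$ with $x>M$), and let $f:F\to\mathbb{R}$ be a function. (a) Suppose that for every $n\in\mathbb{N}$, every closed convex cone $\mathscr{C}\subseteq\mathbb{R}^n$ and every $x=(x_1,\dots,x_n)\in F^n$ such that $(x_ic_i)_{i=1,\dots,n}\in\mathscr{C}$ whenever $c\in\mathscr{C}$, one has $(f(x_i)c_i)_{i=1,\dots,n}\in\mathscr{C}$ whenever $c\in\mathscr{C}$. Then $f$ analytically continues to an entire function with nonnegative power series coefficients at $0$. (b) Suppose that for every $n\in\mathbb{N}$, every closed convex set $\mathscr{C}\subseteq\mathbb{R}^n$ and every $x\in F^n$ such that $(x_ic_i)_{i=1,\dots,n}\in\mathscr{C}$ whenever $c\in\mathscr{C}$, one has $(f(x_i)c_i)_{i=1,\dots,n}\in\mathscr{C}$ whenever $c\in\mathscr{C}$. Then $f$ analytically continues to an entire function with nonnegative power series coefficients at $0$ whose sum is $1$.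
   Context: "$f$ analytically continues to an entire function" means that there is an entire function on $\mathbb{C}$ whose restriction to $F$ equals $f$. The set $F$ is not assumed open or connected. *)

theory Defs
  imports
    "HOL-Complex_Analysis.Complex_Analysis"
    "HOL-Library.Function_Algebras"
begin

(* Pointwise real vector space structure on function spaces. Together with the library topology
   "Euclidean_space n", whose points are the sequences nat => real vanishing at all indices >= n,
   it makes the library notions convex and cone available for subsets of R^n with n a
   variable. *)

instantiation "fun" :: (type, real_vector) real_vector
begin

definition scaleR_fun :: "real \<Rightarrow> ('a \<Rightarrow> 'b) \<Rightarrow> 'a \<Rightarrow> 'b" where
  "scaleR_fun r f = (\<lambda>x. r *\<^sub>R f x)"

instance
  by standard (auto simp: scaleR_fun_def plus_fun_def fun_eq_iff scaleR_add_right scaleR_add_left)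

end

(* C is mapped into itself by the diagonal matrix with diagonal entries x 0, x 1, ... ;
   for C a subset of R^n only x 0, ..., x (n - 1) matter. *)
definition diag_invariant :: "(nat \<Rightarrow> real) \<Rightarrow> (nat \<Rightarrow> real) set \<Rightarrow> bool" where
  "diag_invariant x C \<longleftrightarrow> (\<forall>c\<in>C. (\<lambda>i. x i * c i) \<in> C)"

definition entire_continuation ::
    "real set \<Rightarrow> (real \<Rightarrow> real) \<Rightarrow> (complex \<Rightarrow> complex) \<Rightarrow> bool" where
  "entire_continuation F f g \<longleftrightarrow>
     g holomorphic_on UNIV \<and> (\<forall>x\<in>F. g (complex_of_real x) = complex_of_real (f x))"

end

theory Submission
  imports Defs
begin

text \<open>
  The vectors \<open>(x\<^sub>1^k, \<dots>, x\<^sub>n^k)\<close>, \<open>k \<ge> 0\<close>, generate a convex cone that the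
  diagonal matrix of \<open>x\<close> maps into itself, because it raises \<open>k\<close> by one; the closure of the cone
  inherits this. The cone contains \<open>(1, \<dots>, 1)\<close>, so the hypothesis puts \<open>(f x\<^sub>1, \<dots>, f x\<^sub>n)\<close>
  into the closure: on each finite subset of \<open>F\<close>, the function \<open>f\<close> is a limit of polynomials with
  nonnegative coefficients (\<open>invariance_imp_approx\<close>). For convex sets in place of cones, the convex
  hull of the same vectors gives polynomials with the additional property that the coefficients
  sum to 1.

  A compactness argument turns these approximations on finite sets into one power series
  (\<open>approx_imp_power_series\<close>). If a polynomial \<open>p\<close> with nonnegative coefficients is close to \<open>f\<close> at a
  point \<open>y > 0\<close>, its \<open>k\<close>-th coefficient is at most \<open>(f y + 1) / y^k\<close>; so the coefficient sequences
  lie in a product of compact intervals. Moreover, for \<open>y > \<bar>x\<bar>\<close> the part of \<open>p x\<close> of degree at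
  least \<open>N\<close> is at most \<open>(\<bar>x\<bar> / y)^N (f y + 1)\<close> in absolute value. As \<open>F\<close> is unbounded, such \<open>y\<close>
  exist in \<open>F\<close>. The resulting estimates of \<open>f x\<close> by partial sums involve finitely many coefficients
  at a time, hence are closed conditions that survive in the product topology, and the tail bound
  does not depend on \<open>p\<close>, so no mass escapes to infinity. By the finite intersection property some
  sequence \<open>a\<close> fulfils all of them at once, which says that \<open>f x\<close> is the sum of \<open>a\<^sub>k x^k\<close> for every
  \<open>x\<close> in \<open>F\<close>. Convergence at arbitrarily large \<open>x\<close> makes the power series entire.

  For the second part the number 1 is adjoined to \<open>F\<close>, with the value 1: the polynomials
  have coefficient sum \<open>p 1 = 1\<close>, and the same compactness argument then yields that the
  coefficients \<open>a\<^sub>k\<close> sum to 1. Without points of \<open>F\<close> beyond 1, which control the tails at 1, only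
  a sum of at most 1 would survive in the limit.
\<close>

section \<open>Approximation on finite sets\<close>

text \<open>The closure in \<open>\<real>\<^sup>n\<close> of the vectors of values of \<open>P\<close> at \<open>x\<close>, described by uniform approximation
  because the ambient type of sequences carries no norm.\<close>
definition value_closure :: "real poly set \<Rightarrow> nat \<Rightarrow> (nat \<Rightarrow> real) \<Rightarrow> (nat \<Rightarrow> real) set" where
  "value_closure P n x =
     {c. (\<forall>i\<ge>n. c i = 0) \<and> (\<forall>e>0. \<exists>p\<in>P. \<forall>i<n. \<bar>c i - poly p (x i)\<bar> < e)}"

definition approximable_on :: "real set \<Rightarrow> real poly set \<Rightarrow> (real \<Rightarrow> real) \<Rightarrow> bool" where
  "approximable_on F P f \<longleftrightarrow>
     (\<forall>S e. finite S \<longrightarrow> S \<subseteq> F \<longrightarrow> e > 0 \<longrightarrow> (\<exists>p\<in>P. \<forall>t\<in>S. \<bar>f t - poly p t\<bar> < e))"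

lemma closedin_value_closure: "closedin (Euclidean_space n) (value_closure P n x)"
proof -
  let ?Z = "{c :: nat \<Rightarrow> real. \<forall>i\<ge>n. c i = 0}"
  let ?C = "{c :: nat \<Rightarrow> real. \<forall>e>0. \<exists>p\<in>P. \<forall>i<n. \<bar>c i - poly p (x i)\<bar> < e}"
  have "open (- ?C)"
  proof (subst open_subopen, intro ballI)
    fix c assume "c \<in> - ?C"
    then obtain e :: real where e: "e > 0"
      and no: "\<not> (\<exists>p\<in>P. \<forall>i<n. \<bar>c i - poly p (x i)\<bar> < e)"
      by auto
    let ?T = "{c'. \<forall>i\<in>{..<n}. c' (id i) \<in> ball (c i) (e/2)}"
    have "open ?T"
      using product_topology_basis'[of "{..<n}" "\<lambda>i. ball (c i) (e/2)" id] by simp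
    moreover have "c \<in> ?T" using e by auto
    moreover have "?T \<subseteq> - ?C"
    proof (intro subsetI ComplI)
      fix c' assume c': "c' \<in> ?T" and all: "c' \<in> ?C"
      obtain p where p: "p \<in> P" "\<forall>i<n. \<bar>c' i - poly p (x i)\<bar> < e/2"
        using all e half_gt_zero by blast
      have "\<bar>c i - poly p (x i)\<bar> < e" if "i < n" for i
      proof -
        have "\<bar>c i - c' i\<bar> < e/2"
          using c' that by (auto simp: dist_real_def)
        moreover have "\<bar>c' i - poly p (x i)\<bar> < e/2" using p that by blast
        ultimately show ?thesis by linarith
      qed
      with p no show False by blast
    qed
    ultimately show "\<exists>T. open T \<and> c \<in> T \<and> T \<subseteq> - ?C" by blast
  qed
  hence "closedin (powertop_real UNIV) ?C"
    by (simp add: euclidean_product_topology closed_def)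
  moreover have "value_closure P n x = ?C \<inter> ?Z"
    by (auto simp: value_closure_def)
  ultimately show ?thesis
    unfolding Euclidean_space_def closedin_subtopology by blast
qed

lemma convex_value_closure:
  assumes "\<And>p q u v. p \<in> P \<Longrightarrow> q \<in> P \<Longrightarrow> u \<ge> 0 \<Longrightarrow> v \<ge> 0 \<Longrightarrow> u + v = 1 \<Longrightarrow>
             smult u p + smult v q \<in> P"
  shows "convex (value_closure P n x)"
proof (rule convexI)
  fix c d :: "nat \<Rightarrow> real" and u v :: real
  assume c: "c \<in> value_closure P n x" and d: "d \<in> value_closure P n x"
    and uv: "0 \<le> u" "0 \<le> v" "u + v = 1"
  have "\<exists>r\<in>P. \<forall>i<n. \<bar>u * c i + v * d i - poly r (x i)\<bar> < e" if e: "e > 0" for e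
  proof -
    obtain p q where p: "p \<in> P" "\<forall>i<n. \<bar>c i - poly p (x i)\<bar> < e"
      and q: "q \<in> P" "\<forall>i<n. \<bar>d i - poly q (x i)\<bar> < e"
      using c d e unfolding value_closure_def by blast
    have "\<bar>u * c i + v * d i - poly (smult u p + smult v q) (x i)\<bar> < e" if "i < n" for i
    proof -
      have "u *\<^sub>R (c i - poly p (x i)) + v *\<^sub>R (d i - poly q (x i)) \<in> ball 0 e"
        using p q that uv by (intro convexD[OF convex_ball]) auto
      thus ?thesis by (simp add: algebra_simps)
    qed
    with assms[OF p(1) q(1) uv] show ?thesis by blast
  qed
  with c d show "u *\<^sub>R c + v *\<^sub>R d \<in> value_closure P n x"
    by (simp add: value_closure_def scaleR_fun_def)
qed

lemma cone_value_closure: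
  assumes "\<And>p u. p \<in> P \<Longrightarrow> u \<ge> 0 \<Longrightarrow> smult u p \<in> P"
  shows "cone (value_closure P n x)"
  unfolding cone_def
proof (intro ballI allI impI)
  fix c and u :: real assume c: "c \<in> value_closure P n x" and u: "0 \<le> u"
  have "\<exists>r\<in>P. \<forall>i<n. \<bar>u * c i - poly r (x i)\<bar> < e" if e: "e > 0" for e
  proof -
    have e': "e / (u + 1) > 0" using e u by simp
    obtain p where p: "p \<in> P" "\<forall>i<n. \<bar>c i - poly p (x i)\<bar> < e / (u + 1)"
      using c e' unfolding value_closure_def by blast
    have "\<bar>u * c i - poly (smult u p) (x i)\<bar> < e" if "i < n" for i
    proof -
      have "\<bar>u * c i - poly (smult u p) (x i)\<bar> = u * \<bar>c i - poly p (x i)\<bar>"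
        using u by (simp add: abs_mult flip: right_diff_distrib)
      also have "\<dots> \<le> u * (e / (u + 1))"
        using p that u by (intro mult_left_mono) (auto simp: less_imp_le)
      also have "\<dots> < e" using e u by (simp add: field_simps)
      finally show ?thesis .
    qed
    with assms[OF p(1) u] show ?thesis by blast
  qed
  with c show "u *\<^sub>R c \<in> value_closure P n x"
    by (simp add: value_closure_def scaleR_fun_def)
qed

text \<open>Applying the diagonal matrix of \<open>x\<close> corresponds to multiplying the polynomial by its
  variable.\<close>
lemma diag_invariant_value_closure:
  assumes "\<And>p. p \<in> P \<Longrightarrow> pCons 0 p \<in> P"
  shows "diag_invariant x (value_closure P n x)"
  unfolding diag_invariant_def
proof
  fix c assume c: "c \<in> value_closure P n x"
  define B where "B = (\<Sum>i<n. \<bar>x i\<bar>) + 1"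
  have B: "B > 0" unfolding B_def by (smt (verit) sum_nonneg abs_ge_zero)
  have xB: "\<bar>x i\<bar> \<le> B" if "i < n" for i
    using member_le_sum[of i "{..<n}" "\<lambda>i. \<bar>x i\<bar>"] that unfolding B_def by auto
  have "\<exists>r\<in>P. \<forall>i<n. \<bar>x i * c i - poly r (x i)\<bar> < e" if e: "e > 0" for e
  proof -
    have e': "e / B > 0" using e B by simp
    obtain p where p: "p \<in> P" "\<forall>i<n. \<bar>c i - poly p (x i)\<bar> < e / B"
      using c e' unfolding value_closure_def by blast
    have "\<bar>x i * c i - poly (pCons 0 p) (x i)\<bar> < e" if "i < n" for i
    proof -
      have "\<bar>x i * c i - poly (pCons 0 p) (x i)\<bar> = \<bar>x i\<bar> * \<bar>c i - poly p (x i)\<bar>"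
        by (simp add: abs_mult flip: right_diff_distrib)
      also have "\<dots> \<le> B * \<bar>c i - poly p (x i)\<bar>"
        using xB[OF that] by (intro mult_right_mono) auto
      also have "\<dots> < B * (e / B)"
        using p that B by (intro mult_strict_left_mono) auto
      finally show ?thesis using B by simp
    qed
    with assms[OF p(1)] show ?thesis by blast
  qed
  with c show "(\<lambda>i. x i * c i) \<in> value_closure P n x"
    by (simp add: value_closure_def)
qed

text \<open>The diagonal matrix of \<open>f \<circ> x\<close> is applied to the vector of ones, the values of the
  polynomial 1.\<close>
lemma invariance_imp_approx:
  assumes one: "1 \<in> P"
    and inv: "\<And>n x. (\<forall>i<n. x i \<in> F) \<Longrightarrow> diag_invariant (\<lambda>i. f (x i)) (value_closure P n x)"
  shows "approximable_on F P f"
  unfolding approximable_on_def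
proof (intro allI impI)
  fix S :: "real set" and e :: real assume "finite S" "S \<subseteq> F" and e: "e > 0"
  then obtain xs where xs: "set xs = S" using finite_list by blast
  let ?x = "\<lambda>i. xs ! i" and ?n = "length xs"
  let ?u = "\<lambda>i. if i < ?n then 1 else 0 :: real"
  have "?u \<in> value_closure P ?n ?x"
    using one unfolding value_closure_def by (auto intro!: bexI[of _ 1])
  moreover have "diag_invariant (\<lambda>i. f (?x i)) (value_closure P ?n ?x)"
    using \<open>S \<subseteq> F\<close> xs by (intro inv) auto
  ultimately have "(\<lambda>i. f (?x i) * ?u i) \<in> value_closure P ?n ?x"
    by (auto simp: diag_invariant_def)
  then obtain p where "p \<in> P" "\<forall>i<?n. \<bar>f (?x i) * ?u i - poly p (?x i)\<bar> < e"
    using e unfolding value_closure_def by blast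
  thus "\<exists>p\<in>P. \<forall>t\<in>S. \<bar>f t - poly p t\<bar> < e"
    using xs by (auto simp: in_set_conv_nth intro!: bexI[of _ p])
qed

section \<open>From finite approximation to a power series\<close>

definition nonneg_polys :: "real poly set" where
  "nonneg_polys = {p. \<forall>k. coeff p k \<ge> 0}"

lemma poly_eq_sum_less:
  fixes p :: "'a :: comm_semiring_1 poly"
  assumes "degree p < M"
  shows "poly p x = (\<Sum>k<M. coeff p k * x ^ k)"
  unfolding poly_altdef
  by (rule sum.mono_neutral_left) (use assms in \<open>auto intro: le_degree\<close>)

lemma nonneg_poly_coeff_le:
  assumes p: "p \<in> nonneg_polys" and y: "y > 0"
  shows "coeff p k \<le> poly p y / y ^ k"
proof -
  have "coeff p k * y ^ k \<le> (\<Sum>k<max (Suc k) (Suc (degree p)). coeff p k * y ^ k)"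
    using p y by (intro member_le_sum) (auto simp: nonneg_polys_def)
  also have "\<dots> = poly p y"
    by (rule poly_eq_sum_less[symmetric]) auto
  finally show ?thesis using y by (simp add: field_simps)
qed

text \<open>In passing from \<open>y\<close> to \<open>x\<close>, the absolute value of each term of degree at least \<open>N\<close> is
  multiplied by at most \<open>(\<bar>x\<bar> / y)^N\<close>, whatever the polynomial.\<close>
lemma nonneg_poly_tail_bound:
  assumes p: "p \<in> nonneg_polys" and y: "\<bar>x\<bar> < y"
  shows "\<bar>poly p x - (\<Sum>k<N. coeff p k * x ^ k)\<bar> \<le> (\<bar>x\<bar> / y) ^ N * poly p y"
proof -
  define M where "M = max N (Suc (degree p))"
  have y0: "y > 0" using y by linarith
  have split: "{..<M} = {..<N} \<union> {N..<M}" unfolding M_def by auto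
  have px: "poly p z = (\<Sum>k<N. coeff p k * z ^ k) + (\<Sum>k=N..<M. coeff p k * z ^ k)" for z
    by (subst poly_eq_sum_less[of p M], simp add: M_def, subst split, rule sum.union_disjoint) auto
  have "\<bar>poly p x - (\<Sum>k<N. coeff p k * x ^ k)\<bar> \<le> (\<Sum>k=N..<M. \<bar>coeff p k * x ^ k\<bar>)"
    by (simp add: px)
  also have "\<dots> \<le> (\<Sum>k=N..<M. (\<bar>x\<bar> / y) ^ N * (coeff p k * y ^ k))"
  proof (rule sum_mono)
    fix k assume k: "k \<in> {N..<M}"
    have ck: "coeff p k \<ge> 0" using p by (auto simp: nonneg_polys_def)
    have "\<bar>coeff p k * x ^ k\<bar> = (\<bar>x\<bar> / y) ^ k * (coeff p k * y ^ k)"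
      using ck y0 by (simp add: abs_mult power_abs power_divide)
    also have "\<dots> \<le> (\<bar>x\<bar> / y) ^ N * (coeff p k * y ^ k)"
      using k y y0 ck by (intro mult_right_mono power_decreasing) auto
    finally show "\<bar>coeff p k * x ^ k\<bar> \<le> (\<bar>x\<bar> / y) ^ N * (coeff p k * y ^ k)" .
  qed
  also have "\<dots> = (\<bar>x\<bar> / y) ^ N * (\<Sum>k=N..<M. coeff p k * y ^ k)"
    by (simp add: sum_distrib_left)
  also have "\<dots> \<le> (\<bar>x\<bar> / y) ^ N * poly p y"
    using p y0 unfolding px[of y]
    by (intro mult_left_mono) (auto simp: nonneg_polys_def intro!: sum_nonneg)
  finally show ?thesis .
qed

text \<open>The coefficient sequences of the approximating polynomials are compared in the product
  topology, where closed conditions that each restrict finitely many coefficients can be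
  intersected over all points of \<open>F\<close> and all tolerances \<open>e\<close>.\<close>
lemma approx_imp_power_series:
  assumes unb: "\<And>M. \<exists>x\<in>F. x > M"
    and approx: "approximable_on F nonneg_polys f"
  shows "\<exists>a. (\<forall>k. a k \<ge> 0) \<and> (\<forall>x\<in>F. (\<lambda>k. a k * x ^ k) sums f x)"
proof -
  obtain y where y: "\<And>x. y x \<in> F" "\<And>x. y x > \<bar>x\<bar>"
  proof -
    have "\<exists>z. z \<in> F \<and> z > \<bar>x\<bar>" for x using unb[of "\<bar>x\<bar>"] by blast
    then show ?thesis using that by metis
  qed
  have y0: "y x > 0" for x using y(2)[of x] by linarith
  define box where "box = (PiE UNIV (\<lambda>k. {0 .. (f (y 0) + 1) / y 0 ^ k}) :: (nat \<Rightarrow> real) set)"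
  define A where "A = (\<lambda>(x, e :: real). {a. \<forall>N.
      \<bar>f x - (\<Sum>k<N. a k * x ^ k)\<bar> \<le> e + (\<bar>x\<bar> / y x) ^ N * (f (y x) + 1)})"
  have "compactin (powertop_real UNIV) box"
    unfolding box_def by (subst compactin_PiE) auto
  hence "compact box" by (simp add: euclidean_product_topology)
  hence "box \<inter> (\<Inter>i \<in> F \<times> {0<..}. A i) \<noteq> {}"
  proof (rule compact_imp_fip_image)
    fix i show "closed (A i)"
      unfolding A_def case_prod_unfold
      by (intro closed_Collect_all closed_Collect_le continuous_intros
            continuous_on_product_coordinates)
  next
    fix I :: "(real \<times> real) set" assume fin: "finite I" and sub: "I \<subseteq> F \<times> {0<..}"
    \<comment> \<open>The values at the auxiliary points have to be controlled as well; an error of at most 1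
      is enough there.\<close>
    define S where "S = insert (y 0) (fst ` I \<union> (\<lambda>i. y (fst i)) ` I)"
    define d where "d = Min (insert 1 (snd ` I))"
    have d: "d > 0" "d \<le> 1" "\<And>i. i \<in> I \<Longrightarrow> d \<le> snd i"
      using fin sub unfolding d_def by auto
    have "finite S" "S \<subseteq> F" using fin sub y unfolding S_def by auto
    then obtain p where p: "p \<in> nonneg_polys" "\<And>t. t \<in> S \<Longrightarrow> \<bar>f t - poly p t\<bar> < d"
      using approx d(1) unfolding approximable_on_def by meson
    have upper: "poly p t \<le> f t + 1" if "t \<in> S" for t
      using p(2)[OF that] d(2) by linarith
    have "coeff p k \<in> {0 .. (f (y 0) + 1) / y 0 ^ k}" for k
    proof -
      have "coeff p k \<le> poly p (y 0) / y 0 ^ k"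
        by (rule nonneg_poly_coeff_le[OF p(1) y0])
      also have "\<dots> \<le> (f (y 0) + 1) / y 0 ^ k"
        using upper[of "y 0"] y0[of 0] by (intro divide_right_mono) (auto simp: S_def)
      finally show ?thesis using p(1) by (simp add: nonneg_polys_def)
    qed
    hence "coeff p \<in> box" by (auto simp: box_def)
    moreover have "coeff p \<in> A i" if i: "i \<in> I" for i
    proof -
      obtain x e where xe: "i = (x, e)" by (cases i)
      have xS: "x \<in> S" "y x \<in> S" and de: "d \<le> e"
        using i d(3)[OF i] unfolding S_def xe by force+
      have "\<bar>f x - (\<Sum>k<N. coeff p k * x ^ k)\<bar> \<le> e + (\<bar>x\<bar> / y x) ^ N * (f (y x) + 1)" for N
      proof -
        have "\<bar>poly p x - (\<Sum>k<N. coeff p k * x ^ k)\<bar> \<le> (\<bar>x\<bar> / y x) ^ N * poly p (y x)"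
          by (rule nonneg_poly_tail_bound[OF p(1) y(2)])
        also have "\<dots> \<le> (\<bar>x\<bar> / y x) ^ N * (f (y x) + 1)"
          using upper[OF xS(2)] y0[of x] by (intro mult_left_mono) auto
        finally show ?thesis using p(2)[OF xS(1)] de by linarith
      qed
      thus ?thesis by (simp add: A_def xe)
    qed
    ultimately show "box \<inter> (\<Inter>i\<in>I. A i) \<noteq> {}" by blast
  qed
  then obtain a where a: "a \<in> box" "\<And>x e. x \<in> F \<Longrightarrow> e > 0 \<Longrightarrow> a \<in> A (x, e)" by auto
  have "(\<lambda>k. a k * x ^ k) sums f x" if x: "x \<in> F" for x
  proof -
    have bound: "\<bar>f x - (\<Sum>k<N. a k * x ^ k)\<bar> \<le> (\<bar>x\<bar> / y x) ^ N * (f (y x) + 1)" for N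
    proof (rule field_le_epsilon)
      fix e :: real assume "e > 0"
      thus "\<bar>f x - (\<Sum>k<N. a k * x ^ k)\<bar> \<le> (\<bar>x\<bar> / y x) ^ N * (f (y x) + 1) + e"
        using a(2)[OF x] by (simp add: A_def add.commute)
    qed
    have "(\<lambda>N. (\<bar>x\<bar> / y x) ^ N * (f (y x) + 1)) \<longlonglongrightarrow> 0"
      using y(2)[of x] y0[of x] by (intro tendsto_mult_left_zero LIMSEQ_power_zero) auto
    hence "(\<lambda>N. (\<Sum>k<N. a k * x ^ k) - f x) \<longlonglongrightarrow> 0"
      by (rule Lim_null_comparison[rotated]) (use bound in \<open>auto simp: abs_minus_commute\<close>)
    thus ?thesis unfolding sums_def using LIM_zero_iff by blast
  qed
  moreover have "a k \<ge> 0" for k using a(1) by (auto simp: box_def PiE_iff)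
  ultimately show ?thesis by blast
qed

lemma power_series_entire_continuation:
  fixes a :: "nat \<Rightarrow> real"
  assumes unb: "\<And>M. \<exists>x\<in>F. x > M"
    and sums: "\<And>x. x \<in> F \<Longrightarrow> (\<lambda>k. a k * x ^ k) sums f x"
  shows "\<exists>g. entire_continuation F f g \<and> (\<forall>k. fps_nth (fps_expansion g 0) k = of_real (a k))"
proof -
  define G where "G = Abs_fps (\<lambda>k. complex_of_real (a k))"
  have csums: "(\<lambda>k. fps_nth G k * of_real x ^ k) sums of_real (f x)" if "x \<in> F" for x
    using sums_of_real[OF sums[OF that], where 'a = complex] by (simp add: G_def)
  have radius: "fps_conv_radius G = \<infinity>"
  proof (rule ereal_top)
    fix B
    obtain x where x: "x \<in> F" "x > \<bar>B\<bar>" using unb by blast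
    have "ereal (norm (complex_of_real x)) \<le> conv_radius (fps_nth G)"
      by (rule conv_radius_geI) (rule sums_summable[OF csums[OF x(1)]])
    moreover have "ereal B \<le> ereal (norm (complex_of_real x))" using x(2) by simp
    ultimately show "ereal B \<le> fps_conv_radius G"
      unfolding fps_conv_radius_def by (rule order_trans[rotated])
  qed
  have "eval_fps G has_fps_expansion G"
    by (simp add: has_fps_expansion_def radius)
  hence "fps_expansion (eval_fps G) 0 = G" by (rule fps_expansion_eqI)
  moreover have "eval_fps G holomorphic_on UNIV"
    by (rule holomorphic_on_eval_fps) (simp add: radius)
  moreover have "eval_fps G (of_real x) = of_real (f x)" if "x \<in> F" for x
    using csums[OF that] by (simp add: eval_fps_def sums_iff)
  ultimately show ?thesis
    unfolding entire_continuation_def by (intro exI[of _ "eval_fps G"]) (simp add: G_def)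
qed

section \<open>The two parts\<close>

lemma nonneg_polys_closed:
  shows "1 \<in> nonneg_polys"
    and "p \<in> nonneg_polys \<Longrightarrow> pCons 0 p \<in> nonneg_polys"
    and "p \<in> nonneg_polys \<Longrightarrow> u \<ge> 0 \<Longrightarrow> smult u p \<in> nonneg_polys"
    and "p \<in> nonneg_polys \<Longrightarrow> q \<in> nonneg_polys \<Longrightarrow> p + q \<in> nonneg_polys"
  by (auto simp: nonneg_polys_def coeff_pCons one_pCons split: nat.split)

lemma cone_invariance_imp_power_series:
  assumes unb: "\<And>M. \<exists>x\<in>F. x > M"
    and inv: "\<And>n C x. closedin (Euclidean_space n) C \<Longrightarrow> convex C \<Longrightarrow> cone C \<Longrightarrow>
      \<forall>i<n. x i \<in> F \<Longrightarrow> diag_invariant x C \<Longrightarrow> diag_invariant (\<lambda>i. f (x i)) C"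
  shows "\<exists>a. (\<forall>k. a k \<ge> 0) \<and> (\<forall>x\<in>F. (\<lambda>k. a k * x ^ k) sums f x)"
proof -
  have "approximable_on F nonneg_polys f"
    by (rule invariance_imp_approx, rule nonneg_polys_closed)
      (rule inv[OF closedin_value_closure convex_value_closure cone_value_closure _
          diag_invariant_value_closure]; blast intro: nonneg_polys_closed)
  with unb show ?thesis by (rule approx_imp_power_series)
qed

lemma convex_invariance_imp_power_series:
  assumes unb: "\<And>M. \<exists>x\<in>F. x > M"
    and inv: "\<And>n C x. closedin (Euclidean_space n) C \<Longrightarrow> convex C \<Longrightarrow>
      \<forall>i<n. x i \<in> F \<Longrightarrow> diag_invariant x C \<Longrightarrow> diag_invariant (\<lambda>i. f (x i)) C"
  shows "\<exists>a. (\<forall>k. a k \<ge> 0) \<and> (\<forall>x\<in>F. (\<lambda>k. a k * x ^ k) sums f x) \<and> a sums 1"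
proof -
  define P where "P = {p \<in> nonneg_polys. poly p 1 = 1}"
  have approx: "approximable_on F P f"
  proof (rule invariance_imp_approx)
    show "diag_invariant (\<lambda>i. f (x i)) (value_closure P n x)" if "\<forall>i<n. x i \<in> F" for n x
      by (rule inv[OF closedin_value_closure convex_value_closure that
            diag_invariant_value_closure]) (auto simp: P_def nonneg_polys_closed)
  qed (simp add: P_def nonneg_polys_closed)
  \<comment> \<open>If 1 already lies in \<open>F\<close>, its old value is the new one.\<close>
  have f1: "f 1 = 1" if "1 \<in> F"
  proof (rule ccontr)
    assume "f 1 \<noteq> 1"
    with that have "\<exists>p\<in>P. \<forall>t\<in>{1}. \<bar>f t - poly p t\<bar> < \<bar>f 1 - 1\<bar>"
      by (intro approx[unfolded approximable_on_def, rule_format]) auto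
    thus False by (auto simp: P_def)
  qed
  have "approximable_on (insert 1 F) nonneg_polys (f(1 := 1))"
    unfolding approximable_on_def
  proof (intro allI impI)
    fix S :: "real set" and e :: real
    assume S: "finite S" "S \<subseteq> insert 1 F" and e: "e > 0"
    then obtain p where "p \<in> P" "\<forall>t\<in>S - {1}. \<bar>f t - poly p t\<bar> < e"
      using approx[unfolded approximable_on_def, rule_format, of "S - {1}" e] by blast
    with e show "\<exists>p\<in>nonneg_polys. \<forall>t\<in>S. \<bar>(f(1 := 1)) t - poly p t\<bar> < e"
      by (auto simp: P_def intro!: bexI[of _ p])
  qed
  moreover have "\<exists>x\<in>insert 1 F. x > M" for M using unb by blast
  ultimately obtain a where a: "\<forall>k. a k \<ge> 0"
      "\<And>x. x \<in> insert 1 F \<Longrightarrow> (\<lambda>k. a k * x ^ k) sums (f(1 := 1)) x"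
    using approx_imp_power_series[of "insert 1 F" "f(1 := 1)"] by blast
  have "(\<lambda>k. a k * x ^ k) sums f x" if "x \<in> F" for x
    using a(2)[of x] f1 that by (cases "x = 1") auto
  moreover have "a sums 1" using a(2)[of 1] by simp
  ultimately show ?thesis using a(1) by blast
qed

theorem mainTheorem2:
  fixes F :: "real set" and f :: "real \<Rightarrow> real"
  assumes "\<forall>M. \<exists>x\<in>F. x > M"
  shows
    "((\<forall>(n::nat) C x.
         closedin (Euclidean_space n) C \<longrightarrow> convex C \<longrightarrow> cone C \<longrightarrow> (\<forall>i<n. x i \<in> F) \<longrightarrow>
         diag_invariant x C \<longrightarrow> diag_invariant (\<lambda>i. f (x i)) C)
      \<longrightarrow> (\<exists>g. entire_continuation F f g \<and>
               (\<forall>k. fps_nth (fps_expansion g 0) k \<in> \<real>\<^sub>\<ge>\<^sub>0)))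
     \<and>
     ((\<forall>(n::nat) C x.
         closedin (Euclidean_space n) C \<longrightarrow> convex C \<longrightarrow> (\<forall>i<n. x i \<in> F) \<longrightarrow>
         diag_invariant x C \<longrightarrow> diag_invariant (\<lambda>i. f (x i)) C)
      \<longrightarrow> (\<exists>g. entire_continuation F f g \<and>
               (\<forall>k. fps_nth (fps_expansion g 0) k \<in> \<real>\<^sub>\<ge>\<^sub>0) \<and>
               (\<lambda>k. fps_nth (fps_expansion g 0) k) sums 1))"
proof (intro conjI impI)
  assume "\<forall>(n::nat) C x.
         closedin (Euclidean_space n) C \<longrightarrow> convex C \<longrightarrow> cone C \<longrightarrow> (\<forall>i<n. x i \<in> F) \<longrightarrow>
         diag_invariant x C \<longrightarrow> diag_invariant (\<lambda>i. f (x i)) C"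
  then obtain a where a: "\<forall>k. a k \<ge> 0" "\<And>x. x \<in> F \<Longrightarrow> (\<lambda>k. a k * x ^ k) sums f x"
    using cone_invariance_imp_power_series[of F f] assms by blast
  obtain g where "entire_continuation F f g" "\<forall>k. fps_nth (fps_expansion g 0) k = of_real (a k)"
    using power_series_entire_continuation[of F a f] assms a(2) by blast
  with a(1) show "\<exists>g. entire_continuation F f g \<and>
      (\<forall>k. fps_nth (fps_expansion g 0) k \<in> \<real>\<^sub>\<ge>\<^sub>0)"
    by (intro exI[of _ g]) simp
next
  assume "\<forall>(n::nat) C x.
         closedin (Euclidean_space n) C \<longrightarrow> convex C \<longrightarrow> (\<forall>i<n. x i \<in> F) \<longrightarrow>
         diag_invariant x C \<longrightarrow> diag_invariant (\<lambda>i. f (x i)) C"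
  then obtain a where a: "\<forall>k. a k \<ge> 0" "\<And>x. x \<in> F \<Longrightarrow> (\<lambda>k. a k * x ^ k) sums f x" "a sums 1"
    using convex_invariance_imp_power_series[of F f] assms by blast
  obtain g where g: "entire_continuation F f g"
      "\<forall>k. fps_nth (fps_expansion g 0) k = of_real (a k)"
    using power_series_entire_continuation[of F a f] assms a(2) by blast
  have "(\<lambda>k. fps_nth (fps_expansion g 0) k) sums 1"
    using sums_of_real[OF a(3), where 'a = complex] g(2) by simp
  with a(1) g show "\<exists>g. entire_continuation F f g \<and>
      (\<forall>k. fps_nth (fps_expansion g 0) k \<in> \<real>\<^sub>\<ge>\<^sub>0) \<and>
      (\<lambda>k. fps_nth (fps_expansion g 0) k) sums 1"
    by (intro exI[of _ g]) simp
qed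

end
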